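(* Let $G$ be a finite CA group with center $Z$ of size $z$, and let $C_1,\dots,C_j$ be the distinct centralizers of non-central elements of $G$ (these are pairwise disjoint apart from the center). Let $\pi$ be the stationary distribution of the commuting chain on $G$, and put $c_i=|C_i|$. If $\pi(C_i\setminus Z)\le \frac12$, then the mixing time of the commuting chain on $G$ satisfies \[\frac{c_i}{4z}\le t_{mix}.\]
   Context: For a finite group $G$ with center $Z$ and $x\in G$, let $C_x=\{h\in G: hx=xh\}$ be the centralizer and $x^G$ the conjugacy class of $x$. $G$ is a CA group if commutativity is a transitive relation on $G\setminus Z$ (equivalently, the centralizer of every non-central element is abelian). The commuting chain on $G$ is the Markov chain with state space $G$ and transition matrix $P(x,y)=\frac{1}{|C_x|}\mathbf 1_{\{xy=yx\}}$; it is irreducible, aperiodic and reversible with stationary distribution $\pi(x)=\frac{1}{k|x^G|}$, where $k$ is the number of conjugacy classes of $G$. Total variation distance: $\Vert\mu-\nu\Vert_{TV}=\sup_{A}|\mu(A)-\nu(A)|$. Put $d(t)=\max_x\Vert P^t(x,\cdot)-\pi\Vert_{TV}$, $t_{mix}(\varepsilon)=\min\{t: d(t)\le\varepsilon\}$, and $t_{mix}=t_{mix}(1/4)$. *)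

theory Defs
  imports "HOL-Algebra.Group_Action" Complex_Main
begin

section \<open>Centralizers, conjugacy classes and CA groups\<close>

definition centralizer :: "('a, 'b) monoid_scheme \<Rightarrow> 'a \<Rightarrow> 'a set" where
  "centralizer G x = {h \<in> carrier G. h \<otimes>\<^bsub>G\<^esub> x = x \<otimes>\<^bsub>G\<^esub> h}"

definition group_center :: "('a, 'b) monoid_scheme \<Rightarrow> 'a set" where
  "group_center G = {x \<in> carrier G. \<forall>g\<in>carrier G. g \<otimes>\<^bsub>G\<^esub> x = x \<otimes>\<^bsub>G\<^esub> g}"

definition conjugacy_class :: "('a, 'b) monoid_scheme \<Rightarrow> 'a \<Rightarrow> 'a set" where
  "conjugacy_class G x = {g \<otimes>\<^bsub>G\<^esub> x \<otimes>\<^bsub>G\<^esub> inv\<^bsub>G\<^esub> g | g. g \<in> carrier G}"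

definition conjugacy_classes :: "('a, 'b) monoid_scheme \<Rightarrow> 'a set set" where
  "conjugacy_classes G = conjugacy_class G ` carrier G"

definition noncentral_centralizers :: "('a, 'b) monoid_scheme \<Rightarrow> 'a set set" where
  "noncentral_centralizers G = centralizer G ` (carrier G - group_center G)"

locale CA_group = group G for G (structure) +
  assumes commute_trans:
    "\<lbrakk>x \<in> carrier G - group_center G; y \<in> carrier G - group_center G;
      w \<in> carrier G - group_center G; x \<otimes> y = y \<otimes> x; y \<otimes> w = w \<otimes> y\<rbrakk>
     \<Longrightarrow> x \<otimes> w = w \<otimes> x"

section \<open>Mixing times of finite Markov chains\<close>

text \<open>
  A Markov chain on a finite state space \<open>S\<close> is given by its transition matrix
  \<open>P :: 'a \<Rightarrow> 'a \<Rightarrow> real\<close>, and a distribution on \<open>S\<close> by its mass function \<open>'a \<Rightarrow> real\<close>;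
  only the values on \<open>S\<close> matter.
\<close>

primrec chain_power :: "'a set \<Rightarrow> ('a \<Rightarrow> 'a \<Rightarrow> real) \<Rightarrow> nat \<Rightarrow> 'a \<Rightarrow> 'a \<Rightarrow> real" where
  "chain_power S P 0 x y = (if x = y then 1 else 0)"
| "chain_power S P (Suc t) x y = (\<Sum>w\<in>S. chain_power S P t x w * P w y)"

definition tv_dist :: "'a set \<Rightarrow> ('a \<Rightarrow> real) \<Rightarrow> ('a \<Rightarrow> real) \<Rightarrow> real" where
  "tv_dist S \<mu> \<nu> = (SUP A\<in>Pow S. \<bar>sum \<mu> A - sum \<nu> A\<bar>)"

definition worst_dist :: "'a set \<Rightarrow> ('a \<Rightarrow> 'a \<Rightarrow> real) \<Rightarrow> ('a \<Rightarrow> real) \<Rightarrow> nat \<Rightarrow> real" where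
  "worst_dist S P \<mu> t = Max ((\<lambda>x. tv_dist S (chain_power S P t x) \<mu>) ` S)"

definition mixing_time ::
    "'a set \<Rightarrow> ('a \<Rightarrow> 'a \<Rightarrow> real) \<Rightarrow> ('a \<Rightarrow> real) \<Rightarrow> real \<Rightarrow> nat" where
  "mixing_time S P \<mu> \<epsilon> = (LEAST t. worst_dist S P \<mu> t \<le> \<epsilon>)"

section \<open>The commuting chain\<close>

definition commuting_chain :: "('a, 'b) monoid_scheme \<Rightarrow> 'a \<Rightarrow> 'a \<Rightarrow> real" where
  "commuting_chain G x y =
     1 / real (card (centralizer G x)) * (if x \<otimes>\<^bsub>G\<^esub> y = y \<otimes>\<^bsub>G\<^esub> x then 1 else 0)"

definition commuting_stationary :: "('a, 'b) monoid_scheme \<Rightarrow> 'a \<Rightarrow> real" where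
  "commuting_stationary G x =
     1 / (real (card (conjugacy_classes G)) * real (card (conjugacy_class G x)))"

definition commuting_mixing_time :: "('a, 'b) monoid_scheme \<Rightarrow> nat" where
  "commuting_mixing_time G =
     mixing_time (carrier G) (commuting_chain G) (commuting_stationary G) (1 / 4)"

text \<open>
  The mass function \<open>commuting_stationary\<close> is the unique stationary distribution of the
  commuting chain of a finite group.
\<close>

definition is_stationary :: "'a set \<Rightarrow> ('a \<Rightarrow> 'a \<Rightarrow> real) \<Rightarrow> ('a \<Rightarrow> real) \<Rightarrow> bool" where
  "is_stationary S P \<mu> \<longleftrightarrow>
     (\<forall>x\<in>S. 0 \<le> \<mu> x) \<and> sum \<mu> S = 1 \<and> (\<forall>y\<in>S. (\<Sum>x\<in>S. \<mu> x * P x y) = \<mu> y)"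

context group
begin

lemma card_centralizer_pos:
  assumes "finite (carrier G)" "x \<in> carrier G"
  shows "0 < card (centralizer G x)"
proof -
  have "x \<in> centralizer G x" "finite (centralizer G x)"
    using assms by (auto simp: centralizer_def)
  then show ?thesis by (auto simp: card_gt_0_iff)
qed

lemma conjugacy_class_eq_orbit:
  assumes "x \<in> carrier G"
  shows "conjugacy_class G x = orbit G (\<lambda>g. \<lambda>h\<in>carrier G. g \<otimes> h \<otimes> inv g) x"
  using assms by (auto simp: conjugacy_class_def orbit_def)

lemma conjugacy_classes_eq_orbits:
  "conjugacy_classes G = orbits G (carrier G) (\<lambda>g. \<lambda>h\<in>carrier G. g \<otimes> h \<otimes> inv g)"
  unfolding conjugacy_classes_def orbits_def
  using conjugacy_class_eq_orbit by (auto simp: image_iff)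

lemma centralizer_eq_stabilizer:
  assumes x: "x \<in> carrier G"
  shows "centralizer G x = stabilizer G (\<lambda>g. \<lambda>h\<in>carrier G. g \<otimes> h \<otimes> inv g) x"
proof -
  have "g \<otimes> x \<otimes> inv g = x \<longleftrightarrow> g \<otimes> x = x \<otimes> g" if "g \<in> carrier G" for g
    using that x by (metis inv_solve_right m_closed)
  then show ?thesis using x by (auto simp: centralizer_def stabilizer_def)
qed

lemma card_conjugacy_class:
  assumes "x \<in> carrier G"
  shows "card (conjugacy_class G x) * card (centralizer G x) = order G"
  using group_action.orbit_stabilizer_theorem[OF action_by_conjugation assms] assms
  by (simp add: conjugacy_class_eq_orbit centralizer_eq_stabilizer)

lemma commuting_stationary_pos:
  assumes "finite (carrier G)" "x \<in> carrier G"
  shows "0 < commuting_stationary G x"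
proof -
  have "0 < order G" using assms(1) by (simp add: order_gt_0_iff_finite)
  then have "card (conjugacy_class G x) \<noteq> 0"
    using card_conjugacy_class[OF assms(2)] by (metis mult_zero_left less_irrefl)
  moreover have "card (conjugacy_classes G) \<noteq> 0"
    using assms by (auto simp: conjugacy_classes_def)
  ultimately show ?thesis by (simp add: commuting_stationary_def)
qed

lemma commuting_chain_reversible:
  assumes "finite (carrier G)" "x \<in> carrier G" "y \<in> carrier G"
  shows "commuting_stationary G x * commuting_chain G x y
       = commuting_stationary G y * commuting_chain G y x"
proof -
  have *: "commuting_stationary G w * (1 / real (card (centralizer G w)))
        = 1 / (real (card (conjugacy_classes G)) * real (order G))" if "w \<in> carrier G" for w
    using card_conjugacy_class[OF that, symmetric]
    by (simp add: commuting_stationary_def mult.assoc)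
  have "commuting_stationary G x * (1 / real (card (centralizer G x)))
      = commuting_stationary G y * (1 / real (card (centralizer G y)))"
    using *[OF assms(2)] *[OF assms(3)] by simp
  then show ?thesis by (auto simp: commuting_chain_def)
qed

lemma sum_commuting_chain:
  assumes "finite (carrier G)" "x \<in> carrier G"
  shows "(\<Sum>y\<in>carrier G. commuting_chain G x y) = 1"
proof -
  have "(\<Sum>y\<in>carrier G. commuting_chain G x y)
      = 1 / real (card (centralizer G x)) * real (card {y \<in> carrier G. x \<otimes> y = y \<otimes> x})"
    using assms(1) unfolding commuting_chain_def sum_distrib_left[symmetric]
    by (simp add: sum.If_cases Int_def conj_commute)
  moreover have "{y \<in> carrier G. x \<otimes> y = y \<otimes> x} = centralizer G x"
    by (auto simp: centralizer_def)
  ultimately show ?thesis using card_centralizer_pos[OF assms] by simp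
qed

lemma sum_commuting_stationary:
  assumes fin: "finite (carrier G)"
  shows "(\<Sum>x\<in>carrier G. commuting_stationary G x) = 1"
proof -
  let ?\<phi> = "\<lambda>g. \<lambda>h\<in>carrier G. g \<otimes> h \<otimes> inv g"
  interpret A: group_action G "carrier G" ?\<phi> by (rule action_by_conjugation)
  have k: "0 < card (conjugacy_classes G)"
    using fin by (auto simp: conjugacy_classes_def card_gt_0_iff)
  have "(\<Sum>x\<in>B. commuting_stationary G x) = 1 / real (card (conjugacy_classes G))"
    if B: "B \<in> orbits G (carrier G) ?\<phi>" for B
  proof -
    from B obtain w where w: "w \<in> carrier G" "B = orbit G ?\<phi> w"
      by (auto simp: orbits_def)
    have "B = conjugacy_class G w" using w conjugacy_class_eq_orbit by simp
    then have sub: "B \<subseteq> carrier G" using w by (auto simp: conjugacy_class_def)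
    have "conjugacy_class G x = B" if "x \<in> B" for x
    proof -
      have x: "x \<in> carrier G" using sub that by auto
      then have "orbit G ?\<phi> x \<in> orbits G (carrier G) ?\<phi>" by (auto simp: orbits_def)
      moreover have "x \<in> orbit G ?\<phi> x" using A.orbit_refl x by blast
      ultimately show ?thesis
        using A.disjoint_union[of "orbit G ?\<phi> x" B] B that
        unfolding conjugacy_class_eq_orbit[OF x] by blast
    qed
    moreover have "w \<in> B" using A.orbit_refl w by blast
    then have "0 < card B" using finite_subset[OF sub fin] by (auto simp: card_gt_0_iff)
    ultimately show ?thesis by (simp add: commuting_stationary_def field_simps)
  qed
  then have "(\<Sum>B\<in>orbits G (carrier G) ?\<phi>. \<Sum>x\<in>B. commuting_stationary G x) = 1"
    using k by (simp add: conjugacy_classes_eq_orbits)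
  then show ?thesis using A.disjoint_sum[OF fin, of "commuting_stationary G"] by metis
qed

theorem is_stationary_commuting_stationary:
  assumes fin: "finite (carrier G)"
  shows "is_stationary (carrier G) (commuting_chain G) (commuting_stationary G)"
proof -
  have "(\<Sum>x\<in>carrier G. commuting_stationary G x * commuting_chain G x y)
      = commuting_stationary G y" if y: "y \<in> carrier G" for y
  proof -
    have "(\<Sum>x\<in>carrier G. commuting_stationary G x * commuting_chain G x y)
        = (\<Sum>x\<in>carrier G. commuting_stationary G y * commuting_chain G y x)"
      using commuting_chain_reversible[OF fin] y by (intro sum.cong) auto
    also have "\<dots> = commuting_stationary G y"
      using sum_commuting_chain[OF fin y] by (simp add: sum_distrib_left[symmetric])
    finally show ?thesis .
  qed
  then show ?thesis
    using commuting_stationary_pos[OF fin] sum_commuting_stationary[OF fin]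
    by (auto simp: is_stationary_def less_imp_le)
qed

theorem is_stationary_commuting_chain_unique:
  assumes fin: "finite (carrier G)"
    and st: "is_stationary (carrier G) (commuting_chain G) \<mu>"
    and a: "a \<in> carrier G"
  shows "\<mu> a = commuting_stationary G a"
proof -
  let ?\<pi> = "commuting_stationary G" and ?P = "commuting_chain G"
  define f where "f x = \<mu> x / ?\<pi> x" for x
  have \<mu>: "\<mu> x = ?\<pi> x * f x" if "x \<in> carrier G" for x
    using commuting_stationary_pos[OF fin that] by (simp add: f_def)
  have harm: "(\<Sum>x\<in>carrier G. ?P y x * f x) = f y" if y: "y \<in> carrier G" for y
  proof -
    have "?\<pi> y * (\<Sum>x\<in>carrier G. ?P y x * f x) = (\<Sum>x\<in>carrier G. \<mu> x * ?P x y)"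
      unfolding sum_distrib_left
    proof (intro sum.cong refl)
      fix x assume x: "x \<in> carrier G"
      show "?\<pi> y * (?P y x * f x) = \<mu> x * ?P x y"
        using commuting_chain_reversible[OF fin x y] \<mu>[OF x] by (simp add: mult_ac)
    qed
    also have "\<dots> = ?\<pi> y * f y" using st y \<mu> by (simp add: is_stationary_def)
    finally show ?thesis using commuting_stationary_pos[OF fin y] by simp
  qed
  have extremal: "f m = f \<one>"
    if m: "m \<in> carrier G" and s: "\<And>x. x \<in> carrier G \<Longrightarrow> 0 \<le> s * (f m - f x)" "s \<noteq> 0" for m s
  proof -
    have "(\<Sum>x\<in>carrier G. ?P m x * (s * (f m - f x)))
        = s * (f m * (\<Sum>x\<in>carrier G. ?P m x) - (\<Sum>x\<in>carrier G. ?P m x * f x))"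
      by (simp add: algebra_simps sum_distrib_left sum_subtractf)
    also have "\<dots> = 0" using harm[OF m] sum_commuting_chain[OF fin m] by simp
    finally have "\<forall>x\<in>carrier G. ?P m x * (s * (f m - f x)) = 0"
      using s(1) fin by (subst (asm) sum_nonneg_eq_0_iff) (auto simp: commuting_chain_def)
    then have "?P m \<one> * (s * (f m - f \<one>)) = 0" by simp
    moreover have "?P m \<one> \<noteq> 0"
      using card_centralizer_pos[OF fin m] m by (simp add: commuting_chain_def)
    ultimately show ?thesis using s(2) by simp
  qed
  have const: "f x = f \<one>" if x: "x \<in> carrier G" for x
  proof -
    have ne: "finite (f ` carrier G)" "f ` carrier G \<noteq> {}" using fin by auto
    obtain M where M: "M \<in> carrier G" "f M = Max (f ` carrier G)"
      using Max_in[OF ne] by auto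
    obtain m where m: "m \<in> carrier G" "f m = Min (f ` carrier G)"
      using Min_in[OF ne] by auto
    have "f M = f \<one>" by (rule extremal[where s = 1]) (use M ne in auto)
    moreover have "f m = f \<one>" by (rule extremal[where s = "-1"]) (use m ne in auto)
    moreover have "f m \<le> f x" "f x \<le> f M" using M m x ne by auto
    ultimately show ?thesis by simp
  qed
  have "1 = (\<Sum>x\<in>carrier G. ?\<pi> x * f \<one>)"
  proof -
    have "sum \<mu> (carrier G) = (\<Sum>x\<in>carrier G. ?\<pi> x * f \<one>)"
      by (intro sum.cong refl) (metis \<mu> const)
    then show ?thesis using st by (simp add: is_stationary_def)
  qed
  also have "\<dots> = f \<one>" using sum_commuting_stationary[OF fin] by (simp add: sum_distrib_right[symmetric])
  finally show ?thesis using \<mu>[OF a] const[OF a] by simp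
qed

end

end

theory Submission
  imports Defs
begin

text \<open>
  Put \<open>A = C\<^sub>i - Z\<close>. Every element of \<open>A\<close> has centralizer \<open>C\<^sub>i\<close>, so a chain started in \<open>A\<close> leaves
  it at each step with probability \<open>z / c\<^sub>i\<close>, and after \<open>t\<close> steps it is still in \<open>A\<close> with
  probability at least \<open>1 - t z / c\<^sub>i\<close>. At the mixing time this probability is at most
  \<open>\<pi>(A) + 1/4 \<le> 3/4\<close>, whence \<open>t z / c\<^sub>i \<ge> 1/4\<close>. That the mixing time is attained at all follows
  from Doeblin's condition: every state jumps to \<open>\<one>\<close> with probability at least \<open>1 / |G|\<close>.
\<close>

lemma tv_dist_ge:
  assumes "finite S" "A \<subseteq> S"
  shows "\<bar>sum \<mu> A - sum \<nu> A\<bar> \<le> tv_dist S \<mu> \<nu>"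
  unfolding tv_dist_def using assms by (intro cSUP_upper) auto

text \<open>For two probability mass functions the sharp bound is half the l1 distance; the missing
  factor is harmless, since this is only used to show that the distance tends to zero.\<close>

lemma tv_dist_le_l1:
  assumes "finite S"
  shows "tv_dist S \<mu> \<nu> \<le> (\<Sum>x\<in>S. \<bar>\<mu> x - \<nu> x\<bar>)"
  unfolding tv_dist_def
proof (rule cSUP_least)
  fix A assume "A \<in> Pow S"
  then have "(\<Sum>x\<in>A. \<bar>\<mu> x - \<nu> x\<bar>) \<le> (\<Sum>x\<in>S. \<bar>\<mu> x - \<nu> x\<bar>)"
    using assms by (intro sum_mono2) auto
  then show "\<bar>sum \<mu> A - sum \<nu> A\<bar> \<le> (\<Sum>x\<in>S. \<bar>\<mu> x - \<nu> x\<bar>)"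
    unfolding sum_subtractf[symmetric] using sum_abs order_trans by fast
qed auto

lemma tv_dist_le_worst_dist:
  assumes "finite S" "x \<in> S"
  shows "tv_dist S (chain_power S P t x) \<mu> \<le> worst_dist S P \<mu> t"
  unfolding worst_dist_def using assms by (intro Max_ge) auto

lemma chain_power_nonneg:
  assumes "\<And>x y. x \<in> S \<Longrightarrow> y \<in> S \<Longrightarrow> 0 \<le> P x y" "y \<in> S"
  shows "0 \<le> chain_power S P t x y"
  using assms(2) by (induction t arbitrary: y) (auto intro!: sum_nonneg mult_nonneg_nonneg assms(1))

lemma sum_chain_power_Suc:
  "(\<Sum>y\<in>A. chain_power S P (Suc t) x y) = (\<Sum>w\<in>S. chain_power S P t x w * (\<Sum>y\<in>A. P w y))"
  unfolding chain_power.simps sum_distrib_left by (rule sum.swap)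

lemma sum_chain_power:
  assumes "finite S" "\<And>x. x \<in> S \<Longrightarrow> (\<Sum>y\<in>S. P x y) = 1" "x \<in> S"
  shows "(\<Sum>y\<in>S. chain_power S P t x y) = 1"
proof (induction t)
  case 0
  show ?case using assms by simp
next
  case (Suc t)
  then show ?case unfolding sum_chain_power_Suc using assms(2) by simp
qed

text \<open>Subtracting \<delta> from column \<open>m\<close> leaves a nonnegative kernel
  \<open>Q\<close> with row sums \<open>1 - \<delta>\<close>. The subtracted part is the same in
  every row, so a signed \<open>f\<close> of total mass zero is mapped alike by \<open>P\<close> and
  \<open>Q\<close>, and the triangle inequality for \<open>Q\<close> gives the factor.\<close>

lemma doeblin_contraction:
  fixes P :: "'a \<Rightarrow> 'a \<Rightarrow> real"
  assumes fin: "finite S" and m: "m \<in> S"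
    and nonneg: "\<And>x y. x \<in> S \<Longrightarrow> y \<in> S \<Longrightarrow> 0 \<le> P x y"
    and stoch: "\<And>x. x \<in> S \<Longrightarrow> (\<Sum>y\<in>S. P x y) = 1"
    and minor: "\<And>x. x \<in> S \<Longrightarrow> \<delta> \<le> P x m"
    and f: "sum f S = 0"
  shows "(\<Sum>y\<in>S. \<bar>\<Sum>x\<in>S. f x * P x y\<bar>) \<le> (1 - \<delta>) * (\<Sum>x\<in>S. \<bar>f x\<bar>)"
proof -
  define Q where "Q x y = P x y - (if y = m then \<delta> else 0)" for x y
  have Q: "0 \<le> Q x y" if "x \<in> S" "y \<in> S" for x y
    using nonneg minor that by (auto simp: Q_def)
  have "(\<Sum>x\<in>S. f x * P x y) = (\<Sum>x\<in>S. f x * Q x y)" for y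
    using f by (simp add: Q_def right_diff_distrib sum_subtractf sum_distrib_right[symmetric])
  then have "(\<Sum>y\<in>S. \<bar>\<Sum>x\<in>S. f x * P x y\<bar>) \<le> (\<Sum>y\<in>S. \<Sum>x\<in>S. \<bar>f x\<bar> * Q x y)"
    using Q by (auto intro!: sum_mono order_trans[OF sum_abs] simp: abs_mult)
  also have "\<dots> = (\<Sum>x\<in>S. \<bar>f x\<bar> * (\<Sum>y\<in>S. Q x y))"
    unfolding sum_distrib_left by (rule sum.swap)
  also have "\<dots> = (\<Sum>x\<in>S. \<bar>f x\<bar> * (1 - \<delta>))"
    using stoch fin m by (simp add: Q_def sum_subtractf)
  finally show ?thesis by (simp add: sum_distrib_right[symmetric] mult.commute)
qed

text \<open>The error \<open>chain_power S P t x y - \<mu> y\<close> has total mass zero in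
  \<open>y\<close>, so the contraction applies at every step. The constant 2 bounds the initial
  error, a difference of two probability mass functions.\<close>

lemma doeblin_l1_bound:
  assumes fin: "finite S" and m: "m \<in> S"
    and nonneg: "\<And>x y. x \<in> S \<Longrightarrow> y \<in> S \<Longrightarrow> 0 \<le> P x y"
    and stoch: "\<And>x. x \<in> S \<Longrightarrow> (\<Sum>y\<in>S. P x y) = 1"
    and minor: "\<And>x. x \<in> S \<Longrightarrow> \<delta> \<le> P x m" and \<delta>: "\<delta> \<le> 1"
    and st: "is_stationary S P \<mu>" and x: "x \<in> S"
  shows "(\<Sum>y\<in>S. \<bar>chain_power S P t x y - \<mu> y\<bar>) \<le> 2 * (1 - \<delta>) ^ t"
proof (induction t)
  case 0
  have "(\<Sum>y\<in>S. \<bar>chain_power S P 0 x y - \<mu> y\<bar>) \<le> (\<Sum>y\<in>S. (if x = y then 1 else 0) + \<mu> y)"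
    using st by (intro sum_mono) (auto simp: is_stationary_def)
  also have "\<dots> = 2" using st fin x by (simp add: sum.distrib is_stationary_def)
  finally show ?case by simp
next
  case (Suc t)
  let ?f = "\<lambda>y. chain_power S P t x y - \<mu> y"
  \<comment> \<open>Stationarity rewrites \<open>\<mu> y\<close> as the sum of
    \<open>\<mu> w * P w y\<close>, so the error itself is propagated by \<open>P\<close>.\<close>
  have "(\<Sum>y\<in>S. \<bar>chain_power S P (Suc t) x y - \<mu> y\<bar>) = (\<Sum>y\<in>S. \<bar>\<Sum>w\<in>S. ?f w * P w y\<bar>)"
    using st by (simp add: is_stationary_def left_diff_distrib sum_subtractf)
  also have "\<dots> \<le> (1 - \<delta>) * (\<Sum>y\<in>S. \<bar>?f y\<bar>)"
    using sum_chain_power[OF fin stoch x] st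
    by (intro doeblin_contraction[OF fin m nonneg stoch minor])
      (auto simp: sum_subtractf is_stationary_def)
  also have "\<dots> \<le> (1 - \<delta>) * (2 * (1 - \<delta>) ^ t)"
    using Suc \<delta> by (intro mult_left_mono) auto
  finally show ?case by (simp add: mult_ac)
qed

text \<open>The \<open>LEAST\<close> defining the mixing time has its intended meaning only if some
  \<open>t\<close> qualifies; the geometric decay supplies one.\<close>

lemma worst_dist_mixing_time_le:
  assumes fin: "finite S" and m: "m \<in> S"
    and nonneg: "\<And>x y. x \<in> S \<Longrightarrow> y \<in> S \<Longrightarrow> 0 \<le> P x y"
    and stoch: "\<And>x. x \<in> S \<Longrightarrow> (\<Sum>y\<in>S. P x y) = 1"
    and minor: "\<And>x. x \<in> S \<Longrightarrow> \<delta> \<le> P x m" and \<delta>: "0 < \<delta>" "\<delta> \<le> 1"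
    and st: "is_stationary S P \<mu>" and \<epsilon>: "0 < \<epsilon>"
  shows "worst_dist S P \<mu> (mixing_time S P \<mu> \<epsilon>) \<le> \<epsilon>"
proof -
  obtain t where t: "(1 - \<delta>) ^ t < \<epsilon> / 2"
    using real_arch_pow_inv[of "\<epsilon> / 2" "1 - \<delta>"] \<delta> \<epsilon> by auto
  have "tv_dist S (chain_power S P t x) \<mu> \<le> \<epsilon>" if x: "x \<in> S" for x
  proof -
    have "tv_dist S (chain_power S P t x) \<mu> \<le> (\<Sum>y\<in>S. \<bar>chain_power S P t x y - \<mu> y\<bar>)"
      by (rule tv_dist_le_l1[OF fin])
    also have "\<dots> \<le> 2 * (1 - \<delta>) ^ t"
      by (rule doeblin_l1_bound[OF fin m nonneg stoch minor \<delta>(2) st x])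
    finally show ?thesis using t by simp
  qed
  then have "worst_dist S P \<mu> t \<le> \<epsilon>"
    unfolding worst_dist_def using fin m by (subst Max_le_iff) auto
  then show ?thesis unfolding mixing_time_def by (rule LeastI)
qed

text \<open>A union bound over the steps: the mass inside \<open>A\<close> never exceeds 1 and each
  step expels at most a fraction \<open>q\<close> of it, so at most \<open>q\<close> is lost per
  step.\<close>

lemma chain_power_stay_ge:
  fixes P :: "'a \<Rightarrow> 'a \<Rightarrow> real"
  assumes fin: "finite S" and A: "A \<subseteq> S" and x: "x \<in> A"
    and nonneg: "\<And>x y. x \<in> S \<Longrightarrow> y \<in> S \<Longrightarrow> 0 \<le> P x y"
    and stoch: "\<And>x. x \<in> S \<Longrightarrow> (\<Sum>y\<in>S. P x y) = 1"
    and stay: "\<And>w. w \<in> A \<Longrightarrow> 1 - q \<le> (\<Sum>y\<in>A. P w y)" and q: "0 \<le> q"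
  shows "1 - real t * q \<le> (\<Sum>y\<in>A. chain_power S P t x y)"
proof (induction t)
  case 0
  show ?case using finite_subset[OF A fin] x by simp
next
  case (Suc t)
  let ?p = "chain_power S P t x"
  have p: "0 \<le> ?p w" if "w \<in> S" for w
    by (rule chain_power_nonneg) (use nonneg that in auto)
  have "sum ?p A \<le> sum ?p S"
    using fin A p by (intro sum_mono2) auto
  then have "sum ?p A \<le> 1"
    using sum_chain_power[OF fin stoch] x A by auto
  then have "sum ?p A * q \<le> q" using mult_right_mono[OF _ q] by fastforce
  then have "1 - real (Suc t) * q \<le> sum ?p A - sum ?p A * q"
    using Suc by (simp add: algebra_simps)
  also have "\<dots> = (\<Sum>w\<in>A. ?p w * (1 - q))"
    by (simp add: right_diff_distrib sum_subtractf sum_distrib_right)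
  also have "\<dots> \<le> (\<Sum>w\<in>A. ?p w * (\<Sum>y\<in>A. P w y))"
    using p A stay by (intro sum_mono mult_left_mono) auto
  \<comment> \<open>The extra summands count paths that re-enter \<open>A\<close> from outside; they
    can only add mass.\<close>
  also have "\<dots> \<le> (\<Sum>w\<in>S. ?p w * (\<Sum>y\<in>A. P w y))"
    using fin A p nonneg by (intro sum_mono2 mult_nonneg_nonneg sum_nonneg) auto
  finally show ?case unfolding sum_chain_power_Suc .
qed

lemma commuting_chain_nonneg: "0 \<le> commuting_chain G x y"
  by (simp add: commuting_chain_def)

lemma group_center_subset_centralizer:
  assumes "x \<in> carrier G"
  shows "group_center G \<subseteq> centralizer G x"
  using assms by (auto simp: group_center_def centralizer_def)

lemma (in group) card_group_center_pos:
  assumes "finite (carrier G)"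
  shows "0 < card (group_center G)"
proof -
  have "\<one> \<in> group_center G" "finite (group_center G)"
    using assms by (auto simp: group_center_def)
  then show ?thesis by (auto simp: card_gt_0_iff)
qed

text \<open>If noncentral \<open>a\<close> and \<open>b\<close> commute, transitivity along
  \<open>h\<close>, \<open>a\<close>, \<open>b\<close> carries each noncentral \<open>h\<close> from
  the centralizer of \<open>a\<close> to that of \<open>b\<close>; central \<open>h\<close> lie in
  both. Exchanging \<open>a\<close> and \<open>b\<close> gives the other inclusion.\<close>

lemma (in CA_group) centralizer_eq:
  assumes "x \<in> carrier G - group_center G" "w \<in> centralizer G x - group_center G"
  shows "centralizer G w = centralizer G x"
proof -
  have w: "w \<in> carrier G - group_center G" and wx: "w \<otimes> x = x \<otimes> w"
    using assms by (auto simp: centralizer_def)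
  have "h \<in> centralizer G b"
    if "a \<in> carrier G - group_center G" "b \<in> carrier G - group_center G" "a \<otimes> b = b \<otimes> a"
      "h \<in> centralizer G a" for a b h
  proof (cases "h \<in> group_center G")
    case True
    then show ?thesis using group_center_subset_centralizer[of b G] that(2) by auto
  next
    case False
    then show ?thesis using commute_trans[of h a b] that by (auto simp: centralizer_def)
  qed
  from this[OF w assms(1) wx] this[OF assms(1) w wx[symmetric]] show ?thesis by blast
qed

text \<open>The chain jumps from \<open>w\<close> to a uniform element of its centralizer, which
  contains the whole center, so the missing mass is the chance of landing in the center.\<close>

lemma (in group) sum_commuting_chain_noncentral:
  assumes fin: "finite (carrier G)" and w: "w \<in> carrier G"
  shows "(\<Sum>y\<in>centralizer G w - group_center G. commuting_chain G w y)
       = 1 - real (card (group_center G)) / real (card (centralizer G w))"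
proof -
  let ?C = "centralizer G w" and ?Z = "group_center G"
  have ZC: "?Z \<subseteq> ?C" using w by (rule group_center_subset_centralizer)
  have C: "finite ?C" using fin by (simp add: centralizer_def)
  have "(\<Sum>y\<in>?C - ?Z. commuting_chain G w y) = (\<Sum>y\<in>?C - ?Z. 1 / real (card ?C))"
    by (intro sum.cong) (auto simp: commuting_chain_def centralizer_def)
  also have "\<dots> = (real (card ?C) - real (card ?Z)) / real (card ?C)"
    using ZC C by (simp add: card_Diff_subset finite_subset card_mono of_nat_diff)
  finally show ?thesis using card_centralizer_pos[OF fin w] by (simp add: diff_divide_distrib)
qed

lemma (in group) worst_dist_commuting_mixing_time_le:
  assumes fin: "finite (carrier G)"
  shows "worst_dist (carrier G) (commuting_chain G) (commuting_stationary G)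
           (commuting_mixing_time G) \<le> 1 / 4"
  unfolding commuting_mixing_time_def
proof (rule worst_dist_mixing_time_le[OF fin one_closed])
  fix x assume x: "x \<in> carrier G"
  show "(\<Sum>y\<in>carrier G. commuting_chain G x y) = 1" by (rule sum_commuting_chain[OF fin x])
  \<comment> \<open>As \<one> commutes with \<open>x\<close>, it is reached with probability one
    over the size of the centralizer, which is at most \<open>order G\<close>.\<close>
  have "card (centralizer G x) \<le> order G"
    unfolding order_def using fin by (intro card_mono) (auto simp: centralizer_def)
  then show "1 / real (order G) \<le> commuting_chain G x \<one>"
    using x card_centralizer_pos[OF fin x] by (simp add: commuting_chain_def frac_le)
next
  have "0 < order G" using fin by (simp add: order_gt_0_iff_finite)
  then show "0 < 1 / real (order G)" "1 / real (order G) \<le> 1" by auto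
  show "is_stationary (carrier G) (commuting_chain G) (commuting_stationary G)"
    by (rule is_stationary_commuting_stationary[OF fin])
qed (simp_all add: commuting_chain_nonneg)

theorem theorem2p1:
  fixes G :: "('a, 'b) monoid_scheme" and C :: "nat \<Rightarrow> 'a set" and i j :: nat
  assumes "CA_group G" and "finite (carrier G)"
    and "bij_betw C {1..j} (noncentral_centralizers G)"
    and "i \<in> {1..j}"
    and "(\<Sum>x\<in>C i - group_center G. commuting_stationary G x) \<le> 1 / 2"
  shows "real (card (C i)) / (4 * real (card (group_center G)))
           \<le> real (commuting_mixing_time G)"
proof -
  interpret CA_group G by (rule assms(1))
  note fin = assms(2)
  let ?S = "carrier G" and ?P = "commuting_chain G" and ?\<pi> = "commuting_stationary G"
  let ?A = "C i - group_center G" and ?t = "commuting_mixing_time G"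
  let ?q = "real (card (group_center G)) / real (card (C i))"
  have "C i \<in> noncentral_centralizers G" using assms(3,4) by (rule bij_betw_apply)
  then obtain x where x: "x \<in> ?S - group_center G" and Ci: "C i = centralizer G x"
    by (auto simp: noncentral_centralizers_def)
  have AS: "?A \<subseteq> ?S" and xA: "x \<in> ?A" using x Ci by (auto simp: centralizer_def)
  \<comment> \<open>Here the CA property enters: each \<open>w\<close> in \<open>?A\<close> has the
    same centralizer \<open>C i\<close>, so the exit probability is \<open>?q\<close> throughout
    \<open>?A\<close>.\<close>
  have stay: "1 - ?q \<le> (\<Sum>y\<in>?A. ?P w y)" if w: "w \<in> ?A" for w
    using sum_commuting_chain_noncentral[OF fin, of w] centralizer_eq[OF x] w AS
    unfolding Ci by auto
  have "1 - real ?t * ?q \<le> sum (chain_power ?S ?P ?t x) ?A"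
    by (rule chain_power_stay_ge[OF fin AS xA])
      (auto simp: commuting_chain_nonneg sum_commuting_chain[OF fin] stay)
  \<comment> \<open>\<open>?A\<close> serves as the test event in the total variation distance, with
    starting state \<open>x\<close> at the mixing time.\<close>
  moreover have "\<bar>sum (chain_power ?S ?P ?t x) ?A - sum ?\<pi> ?A\<bar> \<le> 1 / 4"
    using tv_dist_ge[OF fin AS, of "chain_power ?S ?P ?t x" ?\<pi>]
      tv_dist_le_worst_dist[OF fin, of x ?P ?t ?\<pi>]
      worst_dist_commuting_mixing_time_le[OF fin] x by auto
  ultimately have "1 / 4 \<le> real ?t * ?q" using assms(5) by linarith
  then show ?thesis
    using card_centralizer_pos[OF fin, of x] card_group_center_pos[OF fin] x
    by (simp add: Ci field_simps)
qed

end
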